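(* Let $\hat{\mathbf{x}}_{w}$ be the features recovered from the augmented representation $\hat{\mathbf{h}}=\mathbf{U}g_c(\mathbf{\Lambda})\mathbf{U}^T\mathbf{x}+\boldsymbol{\epsilon}$ by $g_w(\lambda_i)$, where $g_w$ is the graph Wiener filter $$g_w(\lambda_i)=\frac{g_c(\lambda_i)}{g_c^2(\lambda_i)+\sigma^2/\mathbb{E}[x_i^{\ast 2}]},$$ and let $\hat{\mathbf{x}}_{inv}$ be the features recovered from $\hat{\mathbf{h}}$ by the inverse filter $g_d(\lambda_i)=g_c^{-1}(\lambda_i)=1/g_c(\lambda_i)$. Then the reconstruction mean square error and the variance of $\hat{\mathbf{x}}_w$ are less than those of $\hat{\mathbf{x}}_{inv}$.
   Context: An undirected graph on $N$ nodes has adjacency matrix $\mathbf{A}\in\{0,1\}^{N\times N}$ and degree matrix $\mathbf{D}$. Its normalized Laplacian is $\mathbf{L}=\mathbf{I}-\mathbf{D}^{-1/2}\mathbf{A}\mathbf{D}^{-1/2}=\mathbf{U}\mathbf{\Lambda}\mathbf{U}^T$, where $\mathbf{U}$ is the orthogonal matrix of eigenvectors and $\mathbf{\Lambda}=\mathrm{diag}(\lambda_1,\dots,\lambda_N)$ contains the eigenvalues. For a filter $g$, $g(\mathbf{\Lambda})=\mathrm{diag}(g(\lambda_1),\dots,g(\lambda_N))$. The graph convolution filter is $g_c$. The vector $\mathbf{x}\in\mathbb{R}^N$ denotes the input features (treated as random in expectations), and $\boldsymbol{\epsilon}\in\mathbb{R}^N$ is any i.i.d. random augmentation with $\mathbb{E}[\epsilon_i]=0$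 and $\mathrm{Var}[\epsilon_i]=\sigma^2$, assumed independent of the input features. The graph spectral projection of the input is $\mathbf{x}^\ast=\mathbf{U}^T\mathbf{x}=(x_1^\ast,\dots,x_N^\ast)$, and $\mathbb{E}[x_i^{\ast 2}]$ is the spectral energy of $\lambda_i$. For a deconvolution filter $g_d$, the recovered features are $\hat{\mathbf{x}}=\mathbf{U}g_d(\mathbf{\Lambda})\mathbf{U}^T\hat{\mathbf{h}}=\mathbf{U}g_d(\mathbf{\Lambda})g_c(\mathbf{\Lambda})\mathbf{U}^T\mathbf{x}+\mathbf{U}g_d(\mathbf{\Lambda})\mathbf{U}^T\boldsymbol{\epsilon}$. The reconstruction mean square error of $\hat{\mathbf{x}}$ is $\mathbb{E}\|\hat{\mathbf{x}}-\mathbf{x}\|_2^2$. The variance of $\hat{\mathbf{x}}$ is the total variance $\sum_{i=1}^N\mathrm{Var}[\hat{x}_i]$, i.e. the trace of its covariance matrix. *)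

theory Defs
  imports "HOL-Probability.Probability"
begin

definition diag_mat :: "real ^ 'n \<Rightarrow> real ^ 'n ^ 'n" where
  "diag_mat v = (\<chi> i j. if i = j then v $ i else 0)"

(* Self-loops are permitted: nothing is required of the diagonal. *)
definition undirected_adjacency :: "real ^ 'n ^ 'n \<Rightarrow> bool" where
  "undirected_adjacency A \<longleftrightarrow> (\<forall>i j. A $ i $ j \<in> {0, 1}) \<and> transpose A = A"

definition degree_vec :: "real ^ 'n::finite ^ 'n \<Rightarrow> real ^ 'n" where
  "degree_vec A = (\<chi> i. \<Sum>j\<in>UNIV. A $ i $ j)"

(* D^(-1/2).  An isolated node gets the entry 1 / sqrt 0 = 0, the usual pseudo-inverse convention. *)
definition inv_sqrt_degree_matrix :: "real ^ 'n::finite ^ 'n \<Rightarrow> real ^ 'n ^ 'n" where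
  "inv_sqrt_degree_matrix A = diag_mat (\<chi> i. 1 / sqrt (degree_vec A $ i))"

definition normalized_laplacian :: "real ^ 'n::finite ^ 'n \<Rightarrow> real ^ 'n ^ 'n" where
  "normalized_laplacian A = mat 1 - inv_sqrt_degree_matrix A ** A ** inv_sqrt_degree_matrix A"

definition laplacian_eigendecomposition ::
  "real ^ 'n::finite ^ 'n \<Rightarrow> real ^ 'n ^ 'n \<Rightarrow> real ^ 'n \<Rightarrow> bool" where
  "laplacian_eigendecomposition A U lam \<longleftrightarrow>
     orthogonal_matrix U \<and> normalized_laplacian A = U ** diag_mat lam ** transpose U"

definition spectral_projection :: "real ^ 'n::finite ^ 'n \<Rightarrow> real ^ 'n \<Rightarrow> real ^ 'n" where
  "spectral_projection U x = transpose U *v x"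

definition spectral_energy ::
  "'w measure \<Rightarrow> real ^ 'n::finite ^ 'n \<Rightarrow> ('w \<Rightarrow> real ^ 'n) \<Rightarrow> 'n \<Rightarrow> real" where
  "spectral_energy M U x i = prob_space.expectation M (\<lambda>\<omega>. (spectral_projection U (x \<omega>) $ i)\<^sup>2)"

(* A filter is given by its vector of responses (g(lambda_1), ..., g(lambda_N)) rather than by a
   function of the eigenvalue: the Wiener response depends on the index i through E[x*_i^2],
   which may differ between indices carrying the same eigenvalue. *)
definition apply_filter :: "real ^ 'n::finite ^ 'n \<Rightarrow> real ^ 'n \<Rightarrow> real ^ 'n \<Rightarrow> real ^ 'n" where
  "apply_filter U r v = (U ** diag_mat r ** transpose U) *v v"

definition conv_response :: "(real \<Rightarrow> real) \<Rightarrow> real ^ 'n \<Rightarrow> real ^ 'n" where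
  "conv_response g lam = (\<chi> i. g (lam $ i))"

definition inverse_response :: "(real \<Rightarrow> real) \<Rightarrow> real ^ 'n \<Rightarrow> real ^ 'n" where
  "inverse_response g lam = (\<chi> i. 1 / g (lam $ i))"

definition wiener_response ::
  "'w measure \<Rightarrow> real ^ 'n::finite ^ 'n \<Rightarrow> real ^ 'n \<Rightarrow> (real \<Rightarrow> real) \<Rightarrow> real \<Rightarrow>
   ('w \<Rightarrow> real ^ 'n) \<Rightarrow> real ^ 'n" where
  "wiener_response M U lam g \<sigma> x =
     (\<chi> i. g (lam $ i) / ((g (lam $ i))\<^sup>2 + \<sigma>\<^sup>2 / spectral_energy M U x i))"

definition augmented_representation ::
  "real ^ 'n::finite ^ 'n \<Rightarrow> real ^ 'n \<Rightarrow> (real \<Rightarrow> real) \<Rightarrow>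
   ('w \<Rightarrow> real ^ 'n) \<Rightarrow> ('w \<Rightarrow> real ^ 'n) \<Rightarrow> 'w \<Rightarrow> real ^ 'n" where
  "augmented_representation U lam g x \<epsilon> \<omega> = apply_filter U (conv_response g lam) (x \<omega>) + \<epsilon> \<omega>"

definition recovered_features ::
  "real ^ 'n::finite ^ 'n \<Rightarrow> real ^ 'n \<Rightarrow> (real \<Rightarrow> real) \<Rightarrow> real ^ 'n \<Rightarrow>
   ('w \<Rightarrow> real ^ 'n) \<Rightarrow> ('w \<Rightarrow> real ^ 'n) \<Rightarrow> 'w \<Rightarrow> real ^ 'n" where
  "recovered_features U lam g r x \<epsilon> \<omega> = apply_filter U r (augmented_representation U lam g x \<epsilon> \<omega>)"

definition reconstruction_mse ::
  "'w measure \<Rightarrow> ('w \<Rightarrow> real ^ 'n::finite) \<Rightarrow> ('w \<Rightarrow> real ^ 'n) \<Rightarrow> real" where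
  "reconstruction_mse M xhat x = prob_space.expectation M (\<lambda>\<omega>. (norm (xhat \<omega> - x \<omega>))\<^sup>2)"

definition total_variance :: "'w measure \<Rightarrow> ('w \<Rightarrow> real ^ 'n::finite) \<Rightarrow> real" where
  "total_variance M X = (\<Sum>i\<in>UNIV. prob_space.variance M (\<lambda>\<omega>. X \<omega> $ i))"

end

theory Submission
  imports Defs
begin

text \<open>
  In the orthonormal eigenbasis the problem decouples: with \<open>E\<close> the spectral energy and
  \<open>c\<close> the value of \<open>g\<^sub>c\<close> at an eigenvalue, a response \<open>r\<close> contributes
  \<open>(r c - 1)\<^sup>2 E + r\<^sup>2 \<sigma>\<^sup>2\<close> to the mean square error and
  \<open>(r c)\<^sup>2 Var[x\<^sup>*] + r\<^sup>2 \<sigma>\<^sup>2\<close> to the variance, because an orthogonal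
  transformation keeps the noise white. For the Wiener response the error is
  \<open>E \<sigma>\<^sup>2 / (c\<^sup>2 E + \<sigma>\<^sup>2)\<close>, and both \<open>r\<^sup>2\<close> and \<open>(r c)\<^sup>2\<close> are smaller than for the inverse
  response, whose error is \<open>\<sigma>\<^sup>2 / c\<^sup>2\<close>.
\<close>

section \<open>Norms and filters in orthonormal coordinates\<close>

lemma power2_norm_vec: "(norm (v :: real ^ 'n))\<^sup>2 = (\<Sum>i\<in>UNIV. (v $ i)\<^sup>2)"
  by (simp add: norm_vec_def L2_set_def sum_nonneg)

lemma norm_orthogonal_matrix_mult:
  fixes Q :: "real ^ 'n ^ 'n"
  assumes "orthogonal_matrix Q"
  shows "norm (Q *v v) = norm v"
proof -
  have "orthogonal_transformation ((*v) Q)"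
    using assms by (simp add: orthogonal_transformation_matrix matrix_vector_mul_linear)
  then show ?thesis
    by (simp add: orthogonal_transformation_norm)
qed

text \<open>Puts filtering into spectral coordinates, where responses act entrywise and successive
  filters multiply.\<close>

lemma apply_filter_eq:
  "apply_filter U r v = U *v (\<chi> i. r $ i * (transpose U *v v) $ i)"
proof -
  have "diag_mat r *v w = (\<chi> i. r $ i * w $ i)" for w
    by (simp add: diag_mat_def matrix_vector_mult_def vec_eq_iff if_distrib if_distribR sum.delta cong: if_cong)
  then show ?thesis
    by (simp add: apply_filter_def matrix_vector_mul_assoc[symmetric])
qed

section \<open>Second moments, total variance and independence\<close>

context prob_space
begin

text \<open>Domination by twice the sum of the squares, which is
  \<open>0 \<le> (a - b)\<^sup>2\<close> rearranged.\<close>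

lemma integrable_power2_add:
  fixes X Y :: "'a \<Rightarrow> real"
  assumes [measurable]: "X \<in> borel_measurable M" "Y \<in> borel_measurable M"
    and "integrable M (\<lambda>\<omega>. (X \<omega>)\<^sup>2)" "integrable M (\<lambda>\<omega>. (Y \<omega>)\<^sup>2)"
  shows "integrable M (\<lambda>\<omega>. (X \<omega> + Y \<omega>)\<^sup>2)"
proof (rule Bochner_Integration.integrable_bound)
  show "integrable M (\<lambda>\<omega>. 2 * (X \<omega>)\<^sup>2 + 2 * (Y \<omega>)\<^sup>2)"
    using assms by simp
  have "(a + b)\<^sup>2 \<le> 2 * a\<^sup>2 + 2 * b\<^sup>2" for a b :: real
    using zero_le_power2[of "a - b"] by (simp add: power2_eq_square algebra_simps)
  then show "AE \<omega> in M. norm ((X \<omega> + Y \<omega>)\<^sup>2) \<le> norm (2 * (X \<omega>)\<^sup>2 + 2 * (Y \<omega>)\<^sup>2)"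
    by simp
qed simp

lemma integrable_power2_sum:
  fixes X :: "'i \<Rightarrow> 'a \<Rightarrow> real"
  assumes "\<And>i. i \<in> I \<Longrightarrow> X i \<in> borel_measurable M"
    and "\<And>i. i \<in> I \<Longrightarrow> integrable M (\<lambda>\<omega>. (X i \<omega>)\<^sup>2)"
  shows "integrable M (\<lambda>\<omega>. (\<Sum>i\<in>I. X i \<omega>)\<^sup>2)"
  using assms
proof (induction I rule: infinite_finite_induct)
  case (insert i I)
  then show ?case
    by (simp add: integrable_power2_add)
qed auto

lemma integrable_power2_matrix_vector_mult:
  fixes X :: "'a \<Rightarrow> real ^ 'n" and Q :: "real ^ 'n ^ 'm"
  assumes [measurable]: "\<And>k. (\<lambda>\<omega>. X \<omega> $ k) \<in> borel_measurable M"
    and "\<And>k. integrable M (\<lambda>\<omega>. (X \<omega> $ k)\<^sup>2)"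
  shows "integrable M (\<lambda>\<omega>. ((Q *v X \<omega>) $ i)\<^sup>2)"
  unfolding matrix_vector_mult_def using assms
  by (auto intro!: integrable_power2_sum simp: power_mult_distrib)

lemma expectation_power2_norm:
  fixes X :: "'a \<Rightarrow> real ^ 'n"
  assumes "\<And>i. integrable M (\<lambda>\<omega>. (X \<omega> $ i)\<^sup>2)"
  shows "expectation (\<lambda>\<omega>. (norm (X \<omega>))\<^sup>2) = (\<Sum>i\<in>UNIV. expectation (\<lambda>\<omega>. (X \<omega> $ i)\<^sup>2))"
  using assms by (simp add: power2_norm_vec)

text \<open>Replaces the coordinatewise definition by a norm, on which the effect of an orthogonal
  map is visible.\<close>

lemma total_variance_eq_expectation_norm:
  fixes X :: "'a \<Rightarrow> real ^ 'n"
  assumes [measurable]: "\<And>i. (\<lambda>\<omega>. X \<omega> $ i) \<in> borel_measurable M"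
    and "\<And>i. integrable M (\<lambda>\<omega>. (X \<omega> $ i)\<^sup>2)"
  shows "total_variance M X =
    expectation (\<lambda>\<omega>. (norm (X \<omega> - (\<chi> i. expectation (\<lambda>\<omega>. X \<omega> $ i))))\<^sup>2)"
proof -
  have "integrable M (\<lambda>\<omega>. (X \<omega> $ i - expectation (\<lambda>\<omega>. X \<omega> $ i))\<^sup>2)" for i
    using integrable_power2_add[of "\<lambda>\<omega>. X \<omega> $ i" "\<lambda>\<omega>. - expectation (\<lambda>\<omega>. X \<omega> $ i)"] assms(2)
    by simp
  then show ?thesis
    by (subst expectation_power2_norm) (simp_all add: total_variance_def)
qed

text \<open>Expectation commutes with the linear map \<open>Q\<close>, so the centred vector is
  itself mapped by \<open>Q\<close> and keeps its norm.\<close>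

lemma total_variance_orthogonal_matrix_mult:
  fixes X :: "'a \<Rightarrow> real ^ 'n" and Q :: "real ^ 'n ^ 'n"
  assumes Q: "orthogonal_matrix Q"
    and meas[measurable]: "\<And>i. (\<lambda>\<omega>. X \<omega> $ i) \<in> borel_measurable M"
    and int: "\<And>i. integrable M (\<lambda>\<omega>. (X \<omega> $ i)\<^sup>2)"
  shows "total_variance M (\<lambda>\<omega>. Q *v X \<omega>) = total_variance M X"
proof -
  have "integrable M (\<lambda>\<omega>. X \<omega> $ i)" for i
    using square_integrable_imp_integrable[OF meas int] .
  then have "(\<chi> i. expectation (\<lambda>\<omega>. (Q *v X \<omega>) $ i)) = Q *v (\<chi> i. expectation (\<lambda>\<omega>. X \<omega> $ i))"
    by (simp add: matrix_vector_mult_def vec_eq_iff)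
  moreover have "(\<lambda>\<omega>. (Q *v X \<omega>) $ i) \<in> borel_measurable M" for i
    by (simp add: matrix_vector_mult_def)
  ultimately have "total_variance M (\<lambda>\<omega>. Q *v X \<omega>) =
      expectation (\<lambda>\<omega>. (norm (Q *v (X \<omega> - (\<chi> i. expectation (\<lambda>\<omega>. X \<omega> $ i)))))\<^sup>2)"
    using integrable_power2_matrix_vector_mult[OF meas int]
    by (subst total_variance_eq_expectation_norm) (simp_all add: matrix_vector_mult_diff_distrib)
  then show ?thesis
    by (simp add: total_variance_eq_expectation_norm int norm_orthogonal_matrix_mult[OF Q])
qed

text \<open>The cross term factors as \<open>2 * expectation X * expectation Y\<close> and vanishes
  as soon as one factor is centred. \<open>X\<close> may keep a nonzero mean, as the signal
  does.\<close>

lemma expectation_power2_add_indep: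
  fixes X Y :: "'a \<Rightarrow> real"
  assumes indep: "indep_var borel X borel Y"
    and X: "integrable M (\<lambda>\<omega>. (X \<omega>)\<^sup>2)" and Y: "integrable M (\<lambda>\<omega>. (Y \<omega>)\<^sup>2)"
    and Y0: "expectation Y = 0"
  shows "expectation (\<lambda>\<omega>. (X \<omega> + Y \<omega>)\<^sup>2) =
    expectation (\<lambda>\<omega>. (X \<omega>)\<^sup>2) + expectation (\<lambda>\<omega>. (Y \<omega>)\<^sup>2)"
proof -
  have "integrable M X" "integrable M Y"
    using square_integrable_imp_integrable[OF indep_var_rv1[OF indep] X]
      square_integrable_imp_integrable[OF indep_var_rv2[OF indep] Y] .
  with indep have "integrable M (\<lambda>\<omega>. X \<omega> * Y \<omega>)" "expectation (\<lambda>\<omega>. X \<omega> * Y \<omega>) = 0"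
    by (simp_all add: indep_var_integrable indep_var_lebesgue_integral Y0)
  then show ?thesis
    using X Y by (simp add: power2_sum mult.assoc)
qed

text \<open>Shifting \<open>X\<close> by its mean preserves independence from \<open>Y\<close>, so
  the second-moment identity applies to the centred \<open>X\<close>.\<close>

lemma variance_add_indep:
  fixes X Y :: "'a \<Rightarrow> real"
  assumes indep: "indep_var borel X borel Y"
    and X: "integrable M (\<lambda>\<omega>. (X \<omega>)\<^sup>2)" and Y: "integrable M (\<lambda>\<omega>. (Y \<omega>)\<^sup>2)"
    and Y0: "expectation Y = 0"
  shows "variance (\<lambda>\<omega>. X \<omega> + Y \<omega>) = variance X + expectation (\<lambda>\<omega>. (Y \<omega>)\<^sup>2)"
proof -
  have [simp]: "integrable M X" "integrable M Y"
    using square_integrable_imp_integrable[OF indep_var_rv1[OF indep] X]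
      square_integrable_imp_integrable[OF indep_var_rv2[OF indep] Y] .
  have "indep_var borel (\<lambda>\<omega>. X \<omega> - expectation X) borel Y"
    by (rule indep_var_compose[OF indep, of "\<lambda>t. t - expectation X" borel "\<lambda>t. t" borel, unfolded comp_def])
      measurable
  moreover have "integrable M (\<lambda>\<omega>. (X \<omega> - expectation X)\<^sup>2)"
    using X by (simp add: power2_diff)
  ultimately have "expectation (\<lambda>\<omega>. (X \<omega> - expectation X + Y \<omega>)\<^sup>2) =
      variance X + expectation (\<lambda>\<omega>. (Y \<omega>)\<^sup>2)"
    using Y Y0 by (rule expectation_power2_add_indep)
  then show ?thesis
    by (simp add: Y0 algebra_simps)
qed

text \<open>Induction: each new variable is independent of the sum of the earlier ones, and that sum
  is again centred.\<close>

lemma expectation_power2_sum_indep: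
  fixes X :: "'i \<Rightarrow> 'a \<Rightarrow> real"
  assumes "finite I" and "indep_vars (\<lambda>_. borel) X I"
    and "\<And>i. i \<in> I \<Longrightarrow> integrable M (\<lambda>\<omega>. (X i \<omega>)\<^sup>2)"
    and "\<And>i. i \<in> I \<Longrightarrow> expectation (X i) = 0"
  shows "expectation (\<lambda>\<omega>. (\<Sum>i\<in>I. X i \<omega>)\<^sup>2) = (\<Sum>i\<in>I. expectation (\<lambda>\<omega>. (X i \<omega>)\<^sup>2))"
  using assms
proof (induction I rule: finite_induct)
  case (insert i I)
  have rv: "X k \<in> borel_measurable M" if "k \<in> insert i I" for k
    using insert.prems(1) that by (auto simp: indep_vars_def)
  have sub: "indep_vars (\<lambda>_. borel) X I"
    by (rule indep_vars_subset[OF insert.prems(1)]) auto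
  have "integrable M (X k)" if "k \<in> insert i I" for k
    by (rule square_integrable_imp_integrable[OF rv[OF that] insert.prems(2)[OF that]])
  then have "expectation (\<lambda>\<omega>. \<Sum>k\<in>I. X k \<omega>) = 0"
    using insert.prems(3) by simp
  moreover have "integrable M (\<lambda>\<omega>. (\<Sum>k\<in>I. X k \<omega>)\<^sup>2)"
    using rv insert.prems(2) by (intro integrable_power2_sum) auto
  moreover have "indep_var borel (X i) borel (\<lambda>\<omega>. \<Sum>k\<in>I. X k \<omega>)"
    using insert by (intro indep_vars_sum) auto
  ultimately have "expectation (\<lambda>\<omega>. (X i \<omega> + (\<Sum>k\<in>I. X k \<omega>))\<^sup>2) =
      expectation (\<lambda>\<omega>. (X i \<omega>)\<^sup>2) + expectation (\<lambda>\<omega>. (\<Sum>k\<in>I. X k \<omega>)\<^sup>2)"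
    using insert.prems(2) by (intro expectation_power2_add_indep) auto
  with insert sub show ?case
    by simp
qed simp

end

section \<open>Signal and white noise in spectral coordinates\<close>

locale noisy_signal = prob_space M for M :: "'w measure" +
  fixes U :: "real ^ 'n::finite ^ 'n"
    and x \<epsilon> :: "'w \<Rightarrow> real ^ 'n"
    and \<sigma> :: real
  assumes orth: "orthogonal_matrix U"
    and x_sq: "\<And>i. integrable M (\<lambda>\<omega>. (x \<omega> $ i)\<^sup>2)"
    and noise_indep: "indep_vars (\<lambda>_. borel) (\<lambda>i \<omega>. \<epsilon> \<omega> $ i) UNIV"
    and noise_sq: "\<And>i. integrable M (\<lambda>\<omega>. (\<epsilon> \<omega> $ i)\<^sup>2)"
    and noise_mean: "\<And>i. expectation (\<lambda>\<omega>. \<epsilon> \<omega> $ i) = 0"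
    and noise_var: "\<And>i. variance (\<lambda>\<omega>. \<epsilon> \<omega> $ i) = \<sigma>\<^sup>2"
    and indep: "indep_var borel x borel \<epsilon>"
begin

abbreviation spec :: "'n \<Rightarrow> 'w \<Rightarrow> real" where
  "spec i \<omega> \<equiv> spectral_projection U (x \<omega>) $ i"

abbreviation noise :: "'n \<Rightarrow> 'w \<Rightarrow> real" where
  "noise i \<omega> \<equiv> spectral_projection U (\<epsilon> \<omega>) $ i"

lemma borel_measurable_spectral_projection:
  "(\<lambda>v. spectral_projection U v $ i) \<in> borel_measurable borel"
  unfolding spectral_projection_def
  by (intro borel_measurable_continuous_onI continuous_intros matrix_vector_mult_linear_continuous_on)

lemma x_measurable [measurable]: "x \<in> borel_measurable M"
  using indep_var_rv1[OF indep] .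

lemma noise_measurable [measurable]: "\<epsilon> \<in> borel_measurable M"
  using indep_var_rv2[OF indep] .

lemma component_measurable [measurable]:
  "(\<lambda>\<omega>. x \<omega> $ i) \<in> borel_measurable M" "(\<lambda>\<omega>. \<epsilon> \<omega> $ i) \<in> borel_measurable M"
  by (auto intro!: measurable_compose[OF x_measurable] measurable_compose[OF noise_measurable]
      borel_measurable_continuous_onI continuous_intros)

lemma spec_measurable [measurable]: "spec i \<in> borel_measurable M"
  by (rule measurable_compose[OF x_measurable borel_measurable_spectral_projection])

lemma noise_spec_measurable [measurable]: "noise i \<in> borel_measurable M"
  by (rule measurable_compose[OF noise_measurable borel_measurable_spectral_projection])

lemma spec_sq: "integrable M (\<lambda>\<omega>. (spec i \<omega>)\<^sup>2)"
  unfolding spectral_projection_def by (rule integrable_power2_matrix_vector_mult) (simp_all add: x_sq)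

lemma noise_spec_sq: "integrable M (\<lambda>\<omega>. (noise i \<omega>)\<^sup>2)"
  unfolding spectral_projection_def by (rule integrable_power2_matrix_vector_mult) (simp_all add: noise_sq)

lemma noise_spec_mean: "expectation (noise i) = 0"
proof -
  have "integrable M (\<lambda>\<omega>. \<epsilon> \<omega> $ k)" for k
    by (rule square_integrable_imp_integrable) (simp_all add: noise_sq)
  then show ?thesis
    by (simp add: spectral_projection_def matrix_vector_mult_def noise_mean)
qed

text \<open>White noise stays white: a spectral coordinate of the noise combines independent centred
  variables of equal variance, with a unit column of \<open>U\<close> as coefficients.\<close>

lemma noise_spec_energy: "expectation (\<lambda>\<omega>. (noise i \<omega>)\<^sup>2) = \<sigma>\<^sup>2"
proof -
  have "expectation (\<lambda>\<omega>. (noise i \<omega>)\<^sup>2) = (\<Sum>k\<in>UNIV. expectation (\<lambda>\<omega>. (U $ k $ i * \<epsilon> \<omega> $ k)\<^sup>2))"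
    unfolding spectral_projection_def matrix_vector_mult_def transpose_def vec_lambda_beta
    \<comment> \<open>Scaling each coordinate by its own constant keeps the family
      independent.\<close>
    using indep_vars_compose2[OF noise_indep, of "\<lambda>k t. U $ k $ i * t" "\<lambda>_. borel"]
    by (intro expectation_power2_sum_indep) (simp_all add: power_mult_distrib noise_sq noise_mean)
  also have "\<dots> = (norm (column i U))\<^sup>2 * \<sigma>\<^sup>2"
    \<comment> \<open>With mean zero, the variance \<open>\<sigma>\<^sup>2\<close> is the second
      moment of each coordinate.\<close>
    using noise_var by (simp add: power_mult_distrib noise_mean power2_norm_vec column_def sum_distrib_right)
  also have "norm (column i U) = 1"
    using orth by (simp add: orthogonal_matrix_orthonormal_columns)
  finally show ?thesis
    by simp
qed

text \<open>Each side is a measurable function of one of the independent vectors \<open>x\<close>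
  and \<open>\<epsilon>\<close>.\<close>

lemma indep_spec_noise: "indep_var borel (\<lambda>\<omega>. a * spec i \<omega>) borel (\<lambda>\<omega>. b * noise i \<omega>)"
  using indep_var_compose[OF indep, of "\<lambda>v. a * spectral_projection U v $ i" borel
      "\<lambda>v. b * spectral_projection U v $ i" borel] borel_measurable_spectral_projection
  by (simp add: comp_def)

lemma scaled_sq:
  "integrable M (\<lambda>\<omega>. (a * spec i \<omega>)\<^sup>2)" "integrable M (\<lambda>\<omega>. (b * noise i \<omega>)\<^sup>2)"
  by (simp_all add: power_mult_distrib spec_sq noise_spec_sq)

lemma energy_combination:
  "expectation (\<lambda>\<omega>. (a * spec i \<omega> + b * noise i \<omega>)\<^sup>2) = a\<^sup>2 * spectral_energy M U x i + b\<^sup>2 * \<sigma>\<^sup>2"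
  using expectation_power2_add_indep[OF indep_spec_noise scaled_sq]
  by (simp add: noise_spec_mean noise_spec_energy power_mult_distrib spectral_energy_def)

text \<open>The noise is centred, so its second moment serves as its variance; the signal need not
  be, hence \<open>variance (spec i)\<close> where the energy stood before.\<close>

lemma variance_combination:
  "variance (\<lambda>\<omega>. a * spec i \<omega> + b * noise i \<omega>) = a\<^sup>2 * variance (spec i) + b\<^sup>2 * \<sigma>\<^sup>2"
proof -
  have "integrable M (spec i)"
    by (rule square_integrable_imp_integrable[OF _ spec_sq]) simp
  then have "variance (\<lambda>\<omega>. a * spec i \<omega>) = a\<^sup>2 * variance (spec i)"
    by (simp add: power_mult_distrib flip: right_diff_distrib)
  then show ?thesis
    using variance_add_indep[OF indep_spec_noise scaled_sq]
    by (simp add: noise_spec_mean noise_spec_energy power_mult_distrib)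
qed

lemma combination_sq: "integrable M (\<lambda>\<omega>. (a * spec i \<omega> + b * noise i \<omega>)\<^sup>2)"
  by (intro integrable_power2_add scaled_sq) simp_all

text \<open>Between the two filters \<open>transpose U ** U\<close> cancels: the signal meets both
  responses, the noise only the recovering one.\<close>

lemma recovered_features_eq:
  "recovered_features U lam g r x \<epsilon> \<omega> =
     U *v (\<chi> i. r $ i * g (lam $ i) * spec i \<omega> + r $ i * noise i \<omega>)"
proof -
  have "transpose U *v (U *v v) = v" for v
    using orth by (simp add: orthogonal_matrix matrix_vector_mul_assoc)
  then show ?thesis
    by (simp add: recovered_features_def augmented_representation_def apply_filter_eq
        conv_response_def spectral_projection_def matrix_vector_right_distrib algebra_simps)
qed

text \<open>Since \<open>x\<close> equals \<open>U\<close> times its projection, subtracting it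
  lowers each signal gain by 1; \<open>U\<close> then drops out of the norm. The response
  \<open>r\<close> is arbitrary, so the formula serves both filters.\<close>

lemma reconstruction_mse_recovered:
  "reconstruction_mse M (recovered_features U lam g r x \<epsilon>) x =
     (\<Sum>i\<in>UNIV. (r $ i * g (lam $ i) - 1)\<^sup>2 * spectral_energy M U x i + (r $ i)\<^sup>2 * \<sigma>\<^sup>2)"
proof -
  have "recovered_features U lam g r x \<epsilon> \<omega> - x \<omega> =
      U *v (\<chi> i. (r $ i * g (lam $ i) - 1) * spec i \<omega> + r $ i * noise i \<omega>)" for \<omega>
  proof -
    have "U *v spectral_projection U (x \<omega>) = x \<omega>"
      unfolding spectral_projection_def matrix_vector_mul_assoc
      using orth by (simp add: orthogonal_matrix_def)
    then have "recovered_features U lam g r x \<epsilon> \<omega> - x \<omega> =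
        U *v ((\<chi> i. r $ i * g (lam $ i) * spec i \<omega> + r $ i * noise i \<omega>) - spectral_projection U (x \<omega>))"
      by (simp add: recovered_features_eq matrix_vector_mult_diff_distrib)
    also have "(\<chi> i. r $ i * g (lam $ i) * spec i \<omega> + r $ i * noise i \<omega>) - spectral_projection U (x \<omega>) =
        (\<chi> i. (r $ i * g (lam $ i) - 1) * spec i \<omega> + r $ i * noise i \<omega>)"
      by (simp add: vec_eq_iff algebra_simps)
    finally show ?thesis .
  qed
  then show ?thesis
    by (simp add: reconstruction_mse_def norm_orthogonal_matrix_mult[OF orth]
        expectation_power2_norm combination_sq energy_combination)
qed

text \<open>The outer \<open>U\<close> does not change total variance, which leaves one scalar
  variance per eigenvalue.\<close>

lemma total_variance_recovered:
  "total_variance M (recovered_features U lam g r x \<epsilon>) =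
     (\<Sum>i\<in>UNIV. (r $ i * g (lam $ i))\<^sup>2 * variance (spec i) + (r $ i)\<^sup>2 * \<sigma>\<^sup>2)"
proof -
  have "total_variance M (recovered_features U lam g r x \<epsilon>) =
      total_variance M (\<lambda>\<omega>. \<chi> i. r $ i * g (lam $ i) * spec i \<omega> + r $ i * noise i \<omega>)"
    unfolding recovered_features_eq
    by (rule total_variance_orthogonal_matrix_mult[OF orth]) (simp_all add: combination_sq)
  then show ?thesis
    by (simp add: total_variance_def variance_combination)
qed

end

section \<open>Wiener against inverse response at a single eigenvalue\<close>

lemma wiener_gain_less:
  fixes c E s :: real
  assumes "c \<noteq> 0" "E > 0" "s \<noteq> 0"
  defines "r \<equiv> c / (c\<^sup>2 + s\<^sup>2 / E)"
  shows "r\<^sup>2 < (1 / c)\<^sup>2" and "(r * c)\<^sup>2 < 1"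
    and "(r * c - 1)\<^sup>2 * E + r\<^sup>2 * s\<^sup>2 < (1 / c)\<^sup>2 * s\<^sup>2"
proof -
  \<comment> \<open>\<open>D\<close> is the Wiener denominator multiplied by \<open>E\<close>, which
    removes the nested fraction.\<close>
  define D where "D = c\<^sup>2 * E + s\<^sup>2"
  have pos: "c\<^sup>2 > 0" "s\<^sup>2 > 0" "D > 0"
    using assms(1-3) unfolding D_def by (auto intro!: add_pos_pos mult_pos_pos)
  have "c\<^sup>2 + s\<^sup>2 / E = D / E"
    using assms(2) by (simp add: D_def add_divide_distrib)
  then have r: "r = c * E / D"
    by (simp add: r_def)
  have rc: "r * c = c\<^sup>2 * E / D"
    by (simp add: r power2_eq_square)
  \<comment> \<open>The overall gain is \<open>c\<^sup>2 * E / D\<close>, and \<open>D\<close>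
    exceeds its numerator by \<open>s\<^sup>2 > 0\<close>.\<close>
  have "0 < r * c" "r * c < 1"
    using pos \<open>E > 0\<close> unfolding rc by (simp_all add: D_def)
  then show 1: "(r * c)\<^sup>2 < 1"
    by (simp add: power_less_one_iff)
  \<comment> \<open>This is the previous bound divided by \<open>c\<^sup>2\<close>.\<close>
  with pos show "r\<^sup>2 < (1 / c)\<^sup>2"
    by (simp add: power_mult_distrib power_divide pos_less_divide_eq)
  have "(r * c - 1)\<^sup>2 * E + r\<^sup>2 * s\<^sup>2 = ((s\<^sup>2)\<^sup>2 * E + c\<^sup>2 * E\<^sup>2 * s\<^sup>2) / D\<^sup>2"
  proof -
    have "r * c - 1 = (c\<^sup>2 * E - D) / D"
      using pos(3) unfolding rc diff_divide_distrib by simp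
    then have "r * c - 1 = - s\<^sup>2 / D"
      by (simp add: D_def)
    then show ?thesis
      by (simp add: r power_divide power_mult_distrib add_divide_distrib)
  qed
  \<comment> \<open>Bias and noise together contain a factor \<open>D\<close>, so the error
    collapses to \<open>s\<^sup>2 * E / D\<close>.\<close>
  also have "(s\<^sup>2)\<^sup>2 * E + c\<^sup>2 * E\<^sup>2 * s\<^sup>2 = s\<^sup>2 * E * D"
    by (simp add: D_def power2_eq_square algebra_simps)
  also have "s\<^sup>2 * E * D / D\<^sup>2 = s\<^sup>2 * (E / D)"
    using pos by (simp add: power2_eq_square)
  also have "\<dots> < s\<^sup>2 * (1 / c)\<^sup>2"
  proof (rule mult_strict_left_mono)
    \<comment> \<open>Cleared of denominators, this is again
      \<open>c\<^sup>2 * E < D\<close>.\<close>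
    show "E / D < (1 / c)\<^sup>2"
      using pos by (simp add: power_divide divide_less_eq less_divide_eq) (simp add: D_def)
  qed (use pos in simp)
  finally show "(r * c - 1)\<^sup>2 * E + r\<^sup>2 * s\<^sup>2 < (1 / c)\<^sup>2 * s\<^sup>2"
    by (simp add: mult.commute)
qed

section \<open>Summation over the spectrum\<close>

theorem proposition4p2:
  fixes M :: "'w measure"
    and A U :: "real ^ 'n::finite ^ 'n"
    and lam :: "real ^ 'n"
    and g\<^sub>c :: "real \<Rightarrow> real"
    and x \<epsilon> :: "'w \<Rightarrow> real ^ 'n"
    and \<sigma> :: real
  assumes "prob_space M"
    and "undirected_adjacency A"
    and "laplacian_eigendecomposition A U lam"
    and "x \<in> borel_measurable M"
    and "\<And>i. integrable M (\<lambda>\<omega>. (x \<omega> $ i)\<^sup>2)"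
    and "\<And>i. spectral_energy M U x i > 0"
    and "\<epsilon> \<in> borel_measurable M"
    and "prob_space.indep_vars M (\<lambda>_. borel) (\<lambda>i \<omega>. \<epsilon> \<omega> $ i) UNIV"
    and "\<And>i j. distr M borel (\<lambda>\<omega>. \<epsilon> \<omega> $ i) = distr M borel (\<lambda>\<omega>. \<epsilon> \<omega> $ j)"
    and "\<And>i. integrable M (\<lambda>\<omega>. (\<epsilon> \<omega> $ i)\<^sup>2)"
    and "\<And>i. prob_space.expectation M (\<lambda>\<omega>. \<epsilon> \<omega> $ i) = 0"
    and "\<And>i. prob_space.variance M (\<lambda>\<omega>. \<epsilon> \<omega> $ i) = \<sigma>\<^sup>2"
    and "\<sigma> \<noteq> 0"
    and "prob_space.indep_var M borel x borel \<epsilon>"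
    and "\<And>i. g\<^sub>c (lam $ i) \<noteq> 0"
  defines "xhat_w \<equiv> recovered_features U lam g\<^sub>c (wiener_response M U lam g\<^sub>c \<sigma> x) x \<epsilon>"
    and "xhat_inv \<equiv> recovered_features U lam g\<^sub>c (inverse_response g\<^sub>c lam) x \<epsilon>"
  shows "reconstruction_mse M xhat_w x < reconstruction_mse M xhat_inv x
       \<and> total_variance M xhat_w < total_variance M xhat_inv"
proof -
  interpret noisy_signal M U x \<epsilon> \<sigma>
    using assms by (intro noisy_signal.intro noisy_signal_axioms.intro)
      (auto simp: laplacian_eigendecomposition_def)
  let ?r = "wiener_response M U lam g\<^sub>c \<sigma> x"
  \<comment> \<open>The indices of the eigenvalue and of the energy are still separate here;
    \<open>[of i i]\<close> identifies them below.\<close>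
  note gain = wiener_gain_less[OF assms(15) assms(6) assms(13)]
  have "reconstruction_mse M xhat_w x < reconstruction_mse M xhat_inv x"
    unfolding xhat_w_def xhat_inv_def reconstruction_mse_recovered
    \<comment> \<open>The inverse response has overall gain 1, so its bias vanishes and only
      \<open>(1 / c)\<^sup>2 * \<sigma>\<^sup>2\<close> remains, with \<open>c\<close> the value of
      \<open>g\<^sub>c\<close>.\<close>
    using gain(3) assms(15)
    by (intro sum_strict_mono) (simp_all add: wiener_response_def inverse_response_def)
  moreover have "total_variance M xhat_w < total_variance M xhat_inv"
    unfolding xhat_w_def xhat_inv_def total_variance_recovered
  \<comment> \<open>A spectral coordinate of the signal may have zero variance, so the signal terms
    are compared weakly; strictness comes from the noise terms, as
    \<open>\<sigma>\<^sup>2 > 0\<close>.\<close>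
  proof (intro sum_strict_mono add_le_less_mono mult_right_mono mult_strict_right_mono)
    fix i
    show "(?r $ i * g\<^sub>c (lam $ i))\<^sup>2 \<le> (inverse_response g\<^sub>c lam $ i * g\<^sub>c (lam $ i))\<^sup>2"
      using gain(2)[of i i] assms(15)[of i] by (simp add: wiener_response_def inverse_response_def)
    show "(?r $ i)\<^sup>2 < (inverse_response g\<^sub>c lam $ i)\<^sup>2"
      using gain(1)[of i i] by (simp add: wiener_response_def inverse_response_def)
  qed (use assms(13) in \<open>simp_all add: variance_positive\<close>)
  ultimately show ?thesis
    by blast
qed

end
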